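(* The semigroup $\mathscr{PO}_\infty(\mathbb{N}^2_\leqslant)$ is isomorphic to the semidirect product $\mathscr{PO}_\infty^{+}(\mathbb{N}^2_\leqslant)\rtimes_{\mathfrak{Q}} H(\mathbb{I})$ of the semigroup $\mathscr{PO}_\infty^{+}(\mathbb{N}^2_\leqslant)$ by the group $H(\mathbb{I})$.
   Context: $\mathbb{N}$ is the set of positive integers with its usual order, and $\mathbb{N}^2_\leqslant$ is $\mathbb{N}\times\mathbb{N}$ with the product order: $(i,m)\leqslant(j,n)$ iff $i\le j$ and $m\le n$. Partial maps are written on the right and composed left to right: $x(\alpha\beta)=(x\alpha)\beta$, with $\operatorname{dom}(\alpha\beta)=\{y\in\operatorname{dom}\alpha : y\alpha\in\operatorname{dom}\beta\}$. A partial map $\alpha\colon X\rightharpoonup X$ of a poset is monotone if $x\leqslant y$ implies $(x)\alpha\leqslant(y)\alpha$ for all $x,y\in\operatorname{dom}\alpha$. $\mathscr{PO}_\infty(\mathbb{N}^2_\leqslant)$ is the monoid, under composition, of all injective monotone partial selfmaps $\alpha$ of $\mathbb{N}^2_\leqslant$ such that $\operatorname{dom}\alpha$ and $\operatorname{ran}\alpha$ have finite complement in $\mathbb{N}\times\mathbb{N}$. $\mathbb{I}$ is its identity (the identity map of $\mathbb{N}\times\mathbb{N}$), and $H(\mathbb{I})$ is its group of units. Put $\mathsf{H}^1=\{(j,1): j\in\mathbb{N}\}$. Define $\mathscr{PO}_\infty^{+}(\mathbb{N}^2_\leqslant)=\{\alpha\in\mathscr{PO}_\infty(\mathbb{N}^2_\leqslant)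 : (\mathsf{H}^1\cap\operatorname{dom}\alpha)\alpha\subseteq\mathsf{H}^1\}$; this is a subsemigroup (known). Let $\varpi$ be the bijection of $\mathbb{N}\times\mathbb{N}$ given by $(i,j)\varpi=(j,i)$. It is known that $H(\mathbb{I})=\{\mathbb{I},\varpi\}\cong\mathbb{Z}_2$. The homomorphism $\mathfrak{Q}\colon H(\mathbb{I})\to\operatorname{Aut}(\mathscr{PO}_\infty^{+}(\mathbb{N}^2_\leqslant))$ sends $\mathbb{I}$ to the identity automorphism and $\varpi$ to the automorphism $\alpha\mapsto\varpi\alpha\varpi$. For semigroups $S,T$ and a homomorphism $\mathfrak{H}\colon T\to\operatorname{End}(S)$, $t\mapsto\mathfrak{h}_t$, the semidirect product $S\rtimes_{\mathfrak{H}}T$ is $S\times T$ with the operation $(s_1,t_1)\cdot(s_2,t_2)=(s_1\cdot(s_2)\mathfrak{h}_{t_1},\,t_1t_2)$. *)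

theory Defs
  imports Main "HOL-Library.Product_Order" "HOL-Algebra.Group"
begin

text \<open>
  The positive quadrant is the set \<open>N2\<close> of pairs of positive elements of \<^typ>\<open>nat\<close>; the order on
  pairs is the componentwise one of \<open>Product_Order\<close>.  A partial selfmap of \<open>N2\<close> is an element of
  \<^typ>\<open>nat \<times> nat \<Rightarrow> (nat \<times> nat) option\<close> with domain and range inside \<open>N2\<close>, so that equality of
  partial selfmaps is equality in this type.
\<close>

type_synonym pmap = "nat \<times> nat \<Rightarrow> (nat \<times> nat) option"

definition N2 :: "(nat \<times> nat) set" where
  "N2 = {0<..} \<times> {0<..}"

definition H1 :: "(nat \<times> nat) set" where
  "H1 = {(j, 1) | j. 0 < j}"

definition id_pmap :: pmap where
  "id_pmap = Some |` N2"

definition varpi :: pmap where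
  "varpi = (\<lambda>(i, j). Some (j, i)) |` N2"

text \<open>Maps act on the right, so the product of \<open>\<alpha>\<close> and \<open>\<beta>\<close> applies \<open>\<alpha>\<close> first.\<close>

definition PO_inf :: "pmap monoid" where
  "PO_inf =
    \<lparr> carrier = {\<alpha>. dom \<alpha> \<subseteq> N2 \<and> ran \<alpha> \<subseteq> N2
                   \<and> inj_on \<alpha> (dom \<alpha>)
                   \<and> mono_on (dom \<alpha>) (\<lambda>x. the (\<alpha> x))
                   \<and> finite (N2 - dom \<alpha>) \<and> finite (N2 - ran \<alpha>)},
      mult = (\<lambda>\<alpha> \<beta>. \<beta> \<circ>\<^sub>m \<alpha>),
      one = id_pmap \<rparr>"

definition PO_plus :: "pmap monoid" where
  "PO_plus = PO_inf
    \<lparr> carrier := {\<alpha> \<in> carrier PO_inf. (\<lambda>x. the (\<alpha> x)) ` (H1 \<inter> dom \<alpha>) \<subseteq> H1} \<rparr>"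

text \<open>
  The left action \<open>h t\<close> of \<open>t\<close> is applied to the second factor.  The unit of the record is the
  pair of units, which plays no role for homomorphisms and isomorphisms of semigroups.
\<close>

definition semidirect ::
    "('a, 'c) monoid_scheme \<Rightarrow> ('b, 'd) monoid_scheme \<Rightarrow> ('b \<Rightarrow> 'a \<Rightarrow> 'a) \<Rightarrow> ('a \<times> 'b) monoid" where
  "semidirect S T h =
    \<lparr> carrier = carrier S \<times> carrier T,
      mult = (\<lambda>(s\<^sub>1, t\<^sub>1) (s\<^sub>2, t\<^sub>2). (s\<^sub>1 \<otimes>\<^bsub>S\<^esub> h t\<^sub>1 s\<^sub>2, t\<^sub>1 \<otimes>\<^bsub>T\<^esub> t\<^sub>2)),
      one = (\<one>\<^bsub>S\<^esub>, \<one>\<^bsub>T\<^esub>) \<rparr>"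

text \<open>
  The group of units of \<open>PO_inf\<close> consists of \<open>id_pmap\<close> and \<open>varpi\<close> only, so the last case concerns
  no unit.
\<close>

definition Q_act :: "pmap \<Rightarrow> pmap \<Rightarrow> pmap" where
  "Q_act \<gamma> =
    (if \<gamma> = id_pmap then (\<lambda>\<alpha>. \<alpha>)
     else if \<gamma> = varpi then (\<lambda>\<alpha>. varpi \<otimes>\<^bsub>PO_inf\<^esub> \<alpha> \<otimes>\<^bsub>PO_inf\<^esub> varpi)
     else undefined)"

end

theory Submission
  imports Defs "HOL-Library.Infinite_Set"
begin

text \<open>
  Call the points \<open>(n, 1)\<close> the horizontal axis and the points \<open>(1, m)\<close> the vertical axis.  The
  theorem says that every \<open>\<alpha>\<close> in \<^const>\<open>PO_inf\<close> factors uniquely as a map in \<^const>\<open>PO_plus\<close> followed by a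
  unit; as units act on \<^const>\<open>PO_plus\<close> by conjugation, multiplying the factors is then an isomorphism.
  Three facts are behind this: \<open>\<alpha>\<close> either preserves or exchanges the two axes, a map that preserves
  the horizontal axis also preserves the vertical one (so that conjugation by \<^const>\<open>varpi\<close> respects
  \<^const>\<open>PO_plus\<close>), and the only units are the identity and \<^const>\<open>varpi\<close>.

  The first two facts rest on a pigeonhole argument.  Let \<open>(n, 1)\<close> have image \<open>(a, b)\<close> with
  \<open>a > 1\<close>.  No point above \<open>(n, 1)\<close> is mapped to the vertical axis, hence almost all of that axis is
  hit by points of the first \<open>n - 1\<close> columns, and one of these columns has infinitely many points with
  image on the vertical axis (\<open>column_into_vertical_axis\<close>).  If \<open>b > 1\<close>, then likewise some column has
  infinitely many points with image on the horizontal axis.  The two cannot happen together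
  (\<open>columns_into_both_axes\<close>): a point of one column lies below points high up in the same column or in one
  to its right, whereas a point of one axis lies below a point of the other axis only if it is
  \<open>(1, 1)\<close>.  So \<open>(n, 1)\<close> is mapped to an axis, and to the same one for all \<open>n\<close>.  If both axes were
  mapped into the horizontal axis, then the first column would have infinitely many points with image
  on the horizontal axis, and the pigeonhole argument for a point \<open>(n, 1)\<close> with image other than
  \<open>(1, 1)\<close> would give a column with infinitely many points with image on the vertical axis,
  which is impossible for the same reason.

  As for units, a total map in \<^const>\<open>PO_plus\<close> sends each axis injectively and monotonically into itself,
  so it moves no point of an axis down, nor any point of the quadrant, since \<open>(n, m)\<close> is the join of
  \<open>(n, 1)\<close> and \<open>(1, m)\<close>.  If its inverse has the same property, it is the identity.
\<close>

section \<open>The monoid of cofinite monotone injections\<close>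

lemma N2_iff: "(i, j) \<in> N2 \<longleftrightarrow> 0 < i \<and> 0 < j"
  by (auto simp: N2_def)

lemma PO_inf_range:
  assumes "\<alpha> \<in> carrier PO_inf" and "\<alpha> x = Some u"
  shows "x \<in> N2" and "u \<in> N2"
  using assms by (auto simp: PO_inf_def intro: ranI)

lemma PO_inf_inj:
  assumes "\<alpha> \<in> carrier PO_inf" and "\<alpha> x = Some u" and "\<alpha> y = Some u"
  shows "x = y"
proof -
  have "inj_on \<alpha> (dom \<alpha>)" using assms(1) by (simp add: PO_inf_def)
  from inj_onD[OF this, of x y] show ?thesis using assms(2,3) by auto
qed

lemma PO_inf_mono:
  assumes "\<alpha> \<in> carrier PO_inf" and "\<alpha> x = Some u" and "\<alpha> y = Some v" and "x \<le> y"
  shows "u \<le> v"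
proof -
  have "mono_on (dom \<alpha>) (\<lambda>x. the (\<alpha> x))" using assms(1) by (simp add: PO_inf_def)
  from mono_onD[OF this, of x y] show ?thesis using assms(2-) by auto
qed

lemma PO_inf_cofinite:
  assumes "\<alpha> \<in> carrier PO_inf"
  shows "finite (N2 - dom \<alpha>)" and "finite (N2 - ran \<alpha>)"
  using assms by (simp_all add: PO_inf_def)

lemma PO_infI:
  assumes "\<And>x u. \<alpha> x = Some u \<Longrightarrow> x \<in> N2" and "\<And>x u. \<alpha> x = Some u \<Longrightarrow> u \<in> N2"
    and "\<And>x y u. \<alpha> x = Some u \<Longrightarrow> \<alpha> y = Some u \<Longrightarrow> x = y"
    and "\<And>x y u v. \<alpha> x = Some u \<Longrightarrow> \<alpha> y = Some v \<Longrightarrow> x \<le> y \<Longrightarrow> u \<le> v"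
    and "finite (N2 - dom \<alpha>)" and "finite (N2 - ran \<alpha>)"
  shows "\<alpha> \<in> carrier PO_inf"
  using assms
  by (auto simp: PO_inf_def ran_def dom_def inj_on_def intro!: mono_onI)

lemma PO_inf_mult: "\<alpha> \<otimes>\<^bsub>PO_inf\<^esub> \<beta> = \<beta> \<circ>\<^sub>m \<alpha>"
  and PO_inf_one: "\<one>\<^bsub>PO_inf\<^esub> = id_pmap"
  by (simp_all add: PO_inf_def)

lemma map_comp_assoc: "(f \<circ>\<^sub>m g) \<circ>\<^sub>m h = f \<circ>\<^sub>m (g \<circ>\<^sub>m h)"
  by (rule ext) (auto simp: map_comp_def split: option.splits)

lemma PO_inf_comp_closed:
  assumes a: "\<alpha> \<in> carrier PO_inf" and b: "\<beta> \<in> carrier PO_inf"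
  shows "\<beta> \<circ>\<^sub>m \<alpha> \<in> carrier PO_inf"
proof (rule PO_infI)
  show "x \<in> N2" if "(\<beta> \<circ>\<^sub>m \<alpha>) x = Some u" for x u
    using that PO_inf_range(1)[OF a] by (metis map_comp_Some_iff)
  show "u \<in> N2" if "(\<beta> \<circ>\<^sub>m \<alpha>) x = Some u" for x u
    using that PO_inf_range(2)[OF b] by (metis map_comp_Some_iff)
  show "x = y" if h: "(\<beta> \<circ>\<^sub>m \<alpha>) x = Some u" "(\<beta> \<circ>\<^sub>m \<alpha>) y = Some u" for x y u
  proof -
    obtain v where "\<alpha> x = Some v" "\<beta> v = Some u"
      using iffD1[OF map_comp_Some_iff h(1)] by metis
    moreover obtain w where "\<alpha> y = Some w" "\<beta> w = Some u"
      using iffD1[OF map_comp_Some_iff h(2)] by metis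
    ultimately show ?thesis using PO_inf_inj[OF a] PO_inf_inj[OF b] by blast
  qed
  show "u \<le> v" if h: "(\<beta> \<circ>\<^sub>m \<alpha>) x = Some u" "(\<beta> \<circ>\<^sub>m \<alpha>) y = Some v" "x \<le> y" for x y u v
  proof -
    obtain p where "\<alpha> x = Some p" "\<beta> p = Some u"
      using iffD1[OF map_comp_Some_iff h(1)] by metis
    moreover obtain q where "\<alpha> y = Some q" "\<beta> q = Some v"
      using iffD1[OF map_comp_Some_iff h(2)] by metis
    ultimately show ?thesis using PO_inf_mono[OF a _ _ h(3)] PO_inf_mono[OF b] by blast
  qed
  have "N2 - dom (\<beta> \<circ>\<^sub>m \<alpha>)
      \<subseteq> (N2 - dom \<alpha>) \<union> ((\<lambda>x. the (\<alpha> x)) -` (N2 - dom \<beta>) \<inter> dom \<alpha>)"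
    using PO_inf_range[OF a] by (auto simp: map_comp_def split: option.splits)
  moreover have "inj_on (\<lambda>x. the (\<alpha> x)) (dom \<alpha>)"
    using PO_inf_inj[OF a] by (auto simp: inj_on_def dom_def)
  ultimately show "finite (N2 - dom (\<beta> \<circ>\<^sub>m \<alpha>))"
    using PO_inf_cofinite[OF a] PO_inf_cofinite[OF b]
    by (meson finite_UnI finite_subset finite_vimage_IntI)
  have "N2 - ran (\<beta> \<circ>\<^sub>m \<alpha>) \<subseteq> (N2 - ran \<beta>) \<union> (\<lambda>y. the (\<beta> y)) ` (N2 - ran \<alpha>)"
  proof
    fix z assume z: "z \<in> N2 - ran (\<beta> \<circ>\<^sub>m \<alpha>)"
    show "z \<in> (N2 - ran \<beta>) \<union> (\<lambda>y. the (\<beta> y)) ` (N2 - ran \<alpha>)"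
    proof (cases "z \<in> ran \<beta>")
      case True
      then obtain y where y: "\<beta> y = Some z" by (auto simp: ran_def)
      have "y \<notin> ran \<alpha>"
      proof
        assume "y \<in> ran \<alpha>"
        then obtain x where "\<alpha> x = Some y" unfolding ran_def by blast
        then have "(\<beta> \<circ>\<^sub>m \<alpha>) x = Some z" using y by simp
        then show False using z by (blast intro: ranI)
      qed
      then have "y \<in> N2 - ran \<alpha>" using PO_inf_range(1)[OF b y] by simp
      moreover have "z = the (\<beta> y)" using y by simp
      ultimately show ?thesis by blast
    qed (use z in auto)
  qed
  then show "finite (N2 - ran (\<beta> \<circ>\<^sub>m \<alpha>))"
    using PO_inf_cofinite[OF a] PO_inf_cofinite[OF b]
    by (meson finite_UnI finite_subset finite_imageI)
qed

section \<open>The identity and the reflection in the diagonal\<close>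

lemma id_pmap_apply: "id_pmap x = (if x \<in> N2 then Some x else None)"
  by (simp add: id_pmap_def restrict_map_def)

lemma varpi_apply: "varpi (i, j) = (if (i, j) \<in> N2 then Some (j, i) else None)"
  by (simp add: varpi_def restrict_map_def)

lemma id_pmap_closed: "id_pmap \<in> carrier PO_inf"
proof (rule PO_infI)
  have "N2 - dom id_pmap = {}" "N2 - ran id_pmap = {}"
    by (auto simp: id_pmap_apply dom_def intro!: ranI)
  then show "finite (N2 - dom id_pmap)" "finite (N2 - ran id_pmap)" by (metis finite.emptyI)+
qed (auto simp: id_pmap_apply split: if_splits)

lemma varpi_closed: "varpi \<in> carrier PO_inf"
proof (rule PO_infI)
  have "N2 - dom varpi = {}" by (auto simp: varpi_apply dom_def)
  then show "finite (N2 - dom varpi)" by (metis finite.emptyI)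
  have "z \<in> ran varpi" if "z \<in> N2" for z
    using that by (cases z) (auto simp: varpi_apply ran_def N2_iff)
  then have "N2 - ran varpi = {}" by blast
  then show "finite (N2 - ran varpi)" by (metis finite.emptyI)
qed (auto simp: varpi_apply N2_iff split: if_splits)

lemma PO_inf_id_left: 
  assumes "\<alpha> \<in> carrier PO_inf" shows "\<alpha> \<circ>\<^sub>m id_pmap = \<alpha>"
proof
  show "(\<alpha> \<circ>\<^sub>m id_pmap) x = \<alpha> x" for x
    using PO_inf_range(1)[OF assms, of x] by (cases "\<alpha> x") (auto simp: map_comp_def id_pmap_apply)
qed

lemma PO_inf_id_right:
  assumes "\<alpha> \<in> carrier PO_inf" shows "id_pmap \<circ>\<^sub>m \<alpha> = \<alpha>"
proof
  show "(id_pmap \<circ>\<^sub>m \<alpha>) x = \<alpha> x" for x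
    using PO_inf_range(2)[OF assms, of x] by (cases "\<alpha> x") (auto simp: map_comp_def id_pmap_apply)
qed

lemma monoid_PO_inf: "monoid PO_inf"
  by (rule monoidI)
    (simp_all add: PO_inf_mult PO_inf_one PO_inf_comp_closed id_pmap_closed PO_inf_id_left
      PO_inf_id_right map_comp_assoc)

lemma varpi_varpi: "varpi \<circ>\<^sub>m varpi = id_pmap"
proof
  show "(varpi \<circ>\<^sub>m varpi) x = id_pmap x" for x
    by (cases x) (auto simp: map_comp_def id_pmap_apply varpi_apply N2_iff)
qed

text \<open>
  Composition with \<^const>\<open>varpi\<close> exchanges the roles of the two axes, in the image when it is applied
  last and in the domain when it is applied first.  The next two rules carry every result about one
  axis over to the other.
\<close>

lemma varpi_comp_Some_iff:
  assumes "\<alpha> \<in> carrier PO_inf"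
  shows "(varpi \<circ>\<^sub>m \<alpha>) x = Some (a, b) \<longleftrightarrow> \<alpha> x = Some (b, a)"
  using PO_inf_range(2)[OF assms, of x]
  by (cases "\<alpha> x") (auto simp: map_comp_def varpi_apply N2_iff split: if_splits)

lemma comp_varpi_Some_iff:
  assumes "\<alpha> \<in> carrier PO_inf"
  shows "(\<alpha> \<circ>\<^sub>m varpi) (i, j) = Some u \<longleftrightarrow> \<alpha> (j, i) = Some u"
  using PO_inf_range(1)[OF assms, of "(j, i)" u]
  by (auto simp: map_comp_def varpi_apply N2_iff split: if_splits)

lemma varpi_involution:
  assumes "\<alpha> \<in> carrier PO_inf"
  shows "varpi \<circ>\<^sub>m (varpi \<circ>\<^sub>m \<alpha>) = \<alpha>"
  using PO_inf_id_right[OF assms] by (simp flip: map_comp_assoc add: varpi_varpi)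

section \<open>Images of the axes\<close>

lemma infinite_on_lines:
  assumes "\<alpha> \<in> carrier PO_inf" and "0 < i"
  shows "infinite {j. (i, j) \<in> dom \<alpha>}" and "infinite {j. (j, i) \<in> dom \<alpha>}"
    and "infinite {j. (i, j) \<in> ran \<alpha>}"
proof -
  have *: "infinite {j. (f j) \<in> D}"
    if "finite (N2 - D)" "inj f" "\<And>j. 0 < j \<Longrightarrow> f j \<in> N2" for f :: "nat \<Rightarrow> _" and D
  proof
    assume fin: "finite {j. f j \<in> D}"
    have "finite (f -` (N2 - D))" using that(1,2) by (rule finite_vimageI)
    moreover have "{0<..} \<subseteq> {j. f j \<in> D} \<union> f -` (N2 - D)" using that(3) by auto
    ultimately show False
      using fin infinite_Ioi[of "0::nat"] by (meson finite_UnI finite_subset)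
  qed
  show "infinite {j. (i, j) \<in> dom \<alpha>}" "infinite {j. (j, i) \<in> dom \<alpha>}"
      "infinite {j. (i, j) \<in> ran \<alpha>}"
    using PO_inf_cofinite[OF assms(1)] assms(2)
    by (intro *; simp add: inj_on_def N2_iff)+
qed

text \<open>
  A point \<open>(i, j)\<close> with \<open>i \<ge> n\<close> lies above \<open>(n, 1)\<close>, so its image has first coordinate at least
  \<open>a > 1\<close>.  The infinitely many points of the vertical axis in the range are therefore images of points
  in finitely many columns.
\<close>

lemma column_into_vertical_axis:
  assumes a: "\<alpha> \<in> carrier PO_inf" and x: "\<alpha> (n, 1) = Some (a, b)" and "a \<noteq> 1"
  obtains i where "infinite {j. \<exists>k. \<alpha> (i, j) = Some (1, k)}"
proof (rule ccontr)
  assume "\<not> thesis"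
  then have fin: "finite {j. \<exists>k. \<alpha> (i, j) = Some (1, k)}" for i using that by blast
  have "1 < a" using PO_inf_range(2)[OF a x] \<open>a \<noteq> 1\<close> by (simp add: N2_iff)
  define S where "S = (\<Union>i<n. Pair i ` {j. \<exists>k. \<alpha> (i, j) = Some (1, k)})"
  have "finite S" unfolding S_def using fin by auto
  have "{k. (1, k) \<in> ran \<alpha>} \<subseteq> (\<lambda>z. snd (the (\<alpha> z))) ` S"
  proof
    fix k assume "k \<in> {k. (1, k) \<in> ran \<alpha>}"
    then obtain i j where ij: "\<alpha> (i, j) = Some (1, k)" by (auto simp: ran_def)
    have "i < n"
    proof (rule ccontr)
      assume "\<not> i < n"
      then have "(n, 1) \<le> (i, j)" using PO_inf_range(1)[OF a ij] by (auto simp: N2_iff)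
      from PO_inf_mono[OF a x ij this] \<open>1 < a\<close> show False by simp
    qed
    then have "(i, j) \<in> S" using ij by (auto simp: S_def)
    then show "k \<in> (\<lambda>z. snd (the (\<alpha> z))) ` S" using ij by force
  qed
  then show False
    using \<open>finite S\<close> infinite_on_lines(3)[OF a, of 1] by (meson finite_imageI finite_subset zero_less_one)
qed

lemma column_into_horizontal_axis:
  assumes a: "\<alpha> \<in> carrier PO_inf" and x: "\<alpha> (n, 1) = Some (a, b)" and "b \<noteq> 1"
  obtains i where "infinite {j. \<exists>k. \<alpha> (i, j) = Some (k, 1)}"
  using column_into_vertical_axis[OF PO_inf_comp_closed[OF a varpi_closed], of n b a] assms that
  by (auto simp: varpi_comp_Some_iff[OF a])

text \<open>
  Every point \<open>(i, j)\<close> lies below points of column \<open>i'\<close> that are mapped to the horizontal axis.  If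
  \<open>(i, j)\<close> itself is mapped to the vertical axis, its image can only be \<open>(1, 1)\<close>; by injectivity this
  happens for at most one \<open>j\<close>.
\<close>

lemma columns_into_both_axes_ordered:
  assumes a: "\<alpha> \<in> carrier PO_inf" and "i \<le> i'"
    and v: "infinite {j. \<exists>k. \<alpha> (i, j) = Some (1, k)}"
    and h: "infinite {j. \<exists>k. \<alpha> (i', j) = Some (k, 1)}"
  shows False
proof -
  have one: "\<alpha> (i, j) = Some (1, 1)" if j: "\<alpha> (i, j) = Some (1, k)" for j k
  proof -
    obtain j' k' where "j < j'" and j': "\<alpha> (i', j') = Some (k', 1)"
      using h unfolding infinite_nat_iff_unbounded by blast
    then have "(1, k) \<le> (k', 1)" using PO_inf_mono[OF a j j'] \<open>i \<le> i'\<close> by simp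
    then show ?thesis using j PO_inf_range(2)[OF a j] by (simp add: N2_iff)
  qed
  obtain j k where j: "\<alpha> (i, j) = Some (1, k)" using v by (auto simp: infinite_nat_iff_unbounded)
  obtain l m where "j < l" and l: "\<alpha> (i, l) = Some (1, m)"
    using v unfolding infinite_nat_iff_unbounded by blast
  show False using PO_inf_inj[OF a one[OF j] one[OF l]] \<open>j < l\<close> by simp
qed

lemma columns_into_both_axes:
  assumes a: "\<alpha> \<in> carrier PO_inf"
    and v: "infinite {j. \<exists>k. \<alpha> (i, j) = Some (1, k)}"
    and h: "infinite {j. \<exists>k. \<alpha> (i', j) = Some (k, 1)}"
  shows False
proof (cases "i \<le> i'")
  case True
  then show ?thesis using columns_into_both_axes_ordered assms by blast
next
  case False
  then show ?thesis
    using columns_into_both_axes_ordered[OF PO_inf_comp_closed[OF a varpi_closed], of i' i] v h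
    by (simp add: varpi_comp_Some_iff[OF a])
qed

text \<open>
  A point with image off the horizontal axis and a point, the same or another one, with image off the
  vertical axis would produce the two columns excluded by \<open>columns_into_both_axes\<close>.
\<close>

lemma horizontal_axis_into_axis:
  assumes a: "\<alpha> \<in> carrier PO_inf"
  shows "(\<forall>n a b. \<alpha> (n, 1) = Some (a, b) \<longrightarrow> b = 1) \<or> (\<forall>n a b. \<alpha> (n, 1) = Some (a, b) \<longrightarrow> a = 1)"
proof (rule ccontr)
  assume "\<not> ?thesis"
  then obtain n c d m p q where x: "\<alpha> (n, 1) = Some (c, d)" "d \<noteq> 1"
    and y: "\<alpha> (m, 1) = Some (p, q)" "p \<noteq> 1" by blast
  obtain i where "infinite {j. \<exists>k. \<alpha> (i, j) = Some (k, 1)}"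
    using column_into_horizontal_axis[OF a x] .
  moreover obtain i' where "infinite {j. \<exists>k. \<alpha> (i', j) = Some (1, k)}"
    using column_into_vertical_axis[OF a y] .
  ultimately show False using columns_into_both_axes[OF a] by blast
qed

lemma PO_plus_iff:
  "\<alpha> \<in> carrier PO_plus \<longleftrightarrow>
    \<alpha> \<in> carrier PO_inf \<and> (\<forall>n a b. \<alpha> (n, 1) = Some (a, b) \<longrightarrow> b = 1)"
proof (cases "\<alpha> \<in> carrier PO_inf")
  case True
  have "(\<lambda>x. the (\<alpha> x)) ` (H1 \<inter> dom \<alpha>) \<subseteq> H1 \<longleftrightarrow>
      (\<forall>n a b. \<alpha> (n, 1) = Some (a, b) \<longrightarrow> b = 1)" (is "?L \<longleftrightarrow> ?R")
  proof
    assume L: ?L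
    show ?R
    proof (intro allI impI)
      fix n a b assume x: "\<alpha> (n, 1) = Some (a, b)"
      then have "(n, 1) \<in> H1 \<inter> dom \<alpha>" using PO_inf_range(1)[OF True x] by (auto simp: H1_def N2_iff)
      then have "the (\<alpha> (n, 1)) \<in> H1" using L by blast
      then show "b = 1" using x by (simp add: H1_def)
    qed
  next
    assume R: ?R
    show ?L
    proof (rule image_subsetI)
      fix x assume "x \<in> H1 \<inter> dom \<alpha>"
      then obtain n c d where "x = (n, 1)" and x: "\<alpha> (n, 1) = Some (c, d)"
        by (auto simp: H1_def)
      then show "the (\<alpha> x) \<in> H1"
        using R PO_inf_range(2)[OF True x] by (auto simp: H1_def N2_iff)
    qed
  qed
  then show ?thesis using True by (simp add: PO_plus_def)
qed (simp add: PO_plus_def)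

lemma PO_plus_or_varpi_PO_plus:
  assumes a: "\<alpha> \<in> carrier PO_inf"
  shows "\<alpha> \<in> carrier PO_plus \<or> varpi \<circ>\<^sub>m \<alpha> \<in> carrier PO_plus"
  using horizontal_axis_into_axis[OF a] a PO_inf_comp_closed[OF a varpi_closed]
  by (auto simp: PO_plus_iff varpi_comp_Some_iff[OF a])

lemma horizontal_axis_unbounded:
  assumes a: "\<alpha> \<in> carrier PO_plus"
  shows "\<exists>n b. \<alpha> (n, 1) = Some (b, 1) \<and> b \<noteq> 1"
proof (rule ccontr)
  have inf: "\<alpha> \<in> carrier PO_inf" using a by (simp add: PO_plus_iff)
  assume "\<not> ?thesis"
  then have no: "b = 1" if "\<alpha> (n, 1) = Some (b, 1)" for n b using that by blast
  have one: "\<alpha> (n, 1) = Some (1, 1)" if "\<alpha> (n, 1) \<noteq> None" for n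
  proof -
    obtain b where "\<alpha> (n, 1) = Some (b, 1)" using \<open>\<alpha> (n, 1) \<noteq> None\<close> a by (auto simp: PO_plus_iff)
    then show ?thesis using no by blast
  qed
  have "infinite {n. (n, 1) \<in> dom \<alpha>}" using infinite_on_lines(2)[OF inf] by simp
  then obtain n m where "n < m" "(n, 1) \<in> dom \<alpha>" "(m, 1) \<in> dom \<alpha>"
    by (metis (no_types, lifting) infinite_nat_iff_unbounded mem_Collect_eq)
  then show False using PO_inf_inj[OF inf one one] by (force simp: domIff)
qed

lemma PO_plus_disjoint_varpi_PO_plus:
  assumes "\<alpha> \<in> carrier PO_plus"
  shows "varpi \<circ>\<^sub>m \<alpha> \<notin> carrier PO_plus"
  using assms by (metis PO_plus_iff horizontal_axis_unbounded varpi_comp_Some_iff)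

text \<open>
  Otherwise the whole first column is mapped into the horizontal axis, while a point \<open>(n, 1)\<close> with
  image \<open>(b, 1)\<close>, \<open>b > 1\<close>, forces some column to meet the vertical axis infinitely often.
\<close>

lemma PO_plus_vertical_axis:
  assumes a: "\<alpha> \<in> carrier PO_plus" and x: "\<alpha> (1, m) = Some (c, d)"
  shows "c = 1"
proof -
  have inf: "\<alpha> \<in> carrier PO_inf" using a by (simp add: PO_plus_iff)
  have False if h: "\<forall>m c d. \<alpha> (1, m) = Some (c, d) \<longrightarrow> d = 1"
  proof -
    have "{j. (1, j) \<in> dom \<alpha>} \<subseteq> {j. \<exists>k. \<alpha> (1, j) = Some (k, 1)}" using h by fastforce
    then have "infinite {j. \<exists>k. \<alpha> (1, j) = Some (k, 1)}"
      using infinite_on_lines(1)[OF inf, of 1] finite_subset by fastforce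
    moreover obtain n b where nb: "\<alpha> (n, 1) = Some (b, 1)" "b \<noteq> 1"
      using horizontal_axis_unbounded[OF a] by blast
    obtain i where "infinite {j. \<exists>k. \<alpha> (i, j) = Some (1, k)}"
      using column_into_vertical_axis[OF inf nb] .
    ultimately show False
      using columns_into_both_axes[OF inf] by blast
  qed
  moreover have "(\<forall>m c d. \<alpha> (1, m) = Some (c, d) \<longrightarrow> d = 1) \<or> (\<forall>m c d. \<alpha> (1, m) = Some (c, d) \<longrightarrow> c = 1)"
    using horizontal_axis_into_axis[OF PO_inf_comp_closed[OF varpi_closed inf]]
    by (simp only: comp_varpi_Some_iff[OF inf])
  ultimately show ?thesis using x by meson
qed

lemma PO_plus_conj_varpi:
  assumes a: "\<alpha> \<in> carrier PO_plus"
  shows "varpi \<circ>\<^sub>m (\<alpha> \<circ>\<^sub>m varpi) \<in> carrier PO_plus"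
proof -
  have inf: "\<alpha> \<in> carrier PO_inf" using a by (simp add: PO_plus_iff)
  note inf' = PO_inf_comp_closed[OF varpi_closed inf]
  show ?thesis
    using PO_plus_vertical_axis[OF a] PO_inf_comp_closed[OF inf' varpi_closed]
    by (auto simp: PO_plus_iff varpi_comp_Some_iff[OF inf'] comp_varpi_Some_iff[OF inf])
qed

section \<open>The group of units\<close>

lemma PO_plus_mult_closed:
  assumes "\<alpha> \<in> carrier PO_plus" and "\<beta> \<in> carrier PO_plus"
  shows "\<beta> \<circ>\<^sub>m \<alpha> \<in> carrier PO_plus"
  using assms PO_inf_comp_closed by (fastforce simp: PO_plus_iff map_comp_Some_iff)

text \<open>
  On each axis the map is a strictly increasing function of a positive integer, so it moves no axis
  point down; and \<open>(n, m)\<close> is the join of \<open>(n, 1)\<close> and \<open>(1, m)\<close>.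
\<close>

lemma PO_plus_total_inflationary:
  assumes a: "\<alpha> \<in> carrier PO_plus" and dom: "dom \<alpha> = N2" and z: "\<alpha> z = Some w"
  shows "z \<le> w"
proof -
  have inf: "\<alpha> \<in> carrier PO_inf" using a by (simp add: PO_plus_iff)
  have total: "\<exists>u v. \<alpha> (i, j) = Some (u, v)" if "0 < i" "0 < j" for i j
  proof -
    have "(i, j) \<in> dom \<alpha>" using that dom by (simp add: N2_iff)
    then show ?thesis by auto
  qed
  have horizontal: "\<exists>p. \<alpha> (Suc n, 1) = Some (p, 1) \<and> Suc n \<le> p" for n
  proof (induction n)
    case 0
    show ?case using total[of 1 1] a PO_inf_range(2)[OF inf] by (force simp: PO_plus_iff N2_iff)
  next
    case (Suc n)
    then obtain p where p: "\<alpha> (Suc n, 1) = Some (p, 1)" "Suc n \<le> p" by blast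
    obtain q where q: "\<alpha> (Suc (Suc n), 1) = Some (q, 1)"
      using total[of "Suc (Suc n)" 1] a by (auto simp: PO_plus_iff)
    have "p \<le> q" using PO_inf_mono[OF inf p(1) q] by simp
    moreover have "p \<noteq> q" using PO_inf_inj[OF inf p(1)] q by fastforce
    ultimately show ?case using p q by auto
  qed
  have vertical: "\<exists>p. \<alpha> (1, Suc n) = Some (1, p) \<and> Suc n \<le> p" for n
  proof (induction n)
    case 0
    show ?case
      using total[of 1 1] PO_plus_vertical_axis[OF a] PO_inf_range(2)[OF inf] by (force simp: N2_iff)
  next
    case (Suc n)
    then obtain p where p: "\<alpha> (1, Suc n) = Some (1, p)" "Suc n \<le> p" by blast
    obtain q where q: "\<alpha> (1, Suc (Suc n)) = Some (1, q)"
      using total[of 1 "Suc (Suc n)"] PO_plus_vertical_axis[OF a] by auto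
    have "p \<le> q" using PO_inf_mono[OF inf p(1) q] by simp
    moreover have "p \<noteq> q" using PO_inf_inj[OF inf p(1)] q by fastforce
    ultimately show ?case using p q by auto
  qed
  obtain n m where nm: "z = (Suc n, Suc m)"
    using PO_inf_range(1)[OF inf z] by (cases z) (auto simp: N2_iff gr0_conv_Suc)
  obtain p where p: "\<alpha> (Suc n, 1) = Some (p, 1)" "Suc n \<le> p" using horizontal by blast
  obtain q where q: "\<alpha> (1, Suc m) = Some (1, q)" "Suc m \<le> q" using vertical by blast
  have "(p, 1) \<le> w" "(1, q) \<le> w"
    using PO_inf_mono[OF inf p(1) z] PO_inf_mono[OF inf q(1) z] nm by auto
  then show ?thesis using p q nm by (cases w) auto
qed

text \<open>
  The inverse cannot exchange the axes, since its product with \<open>\<alpha>\<close> preserves them.  Hence both maps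
  move points only upwards, and they cancel.
\<close>

lemma PO_plus_unit:
  assumes a: "\<alpha> \<in> carrier PO_plus" and b: "\<beta> \<in> carrier PO_inf"
    and ba: "\<beta> \<circ>\<^sub>m \<alpha> = id_pmap" and ab: "\<alpha> \<circ>\<^sub>m \<beta> = id_pmap"
  shows "\<alpha> = id_pmap"
proof -
  have inf: "\<alpha> \<in> carrier PO_inf" using a by (simp add: PO_plus_iff)
  have id_plus: "id_pmap \<in> carrier PO_plus"
    using id_pmap_closed by (auto simp: PO_plus_iff id_pmap_apply split: if_splits)
  have b_plus: "\<beta> \<in> carrier PO_plus"
  proof (rule ccontr)
    assume "\<beta> \<notin> carrier PO_plus"
    then have "varpi \<circ>\<^sub>m \<beta> \<in> carrier PO_plus" using PO_plus_or_varpi_PO_plus[OF b] by simp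
    from PO_plus_mult_closed[OF a this] have "varpi \<circ>\<^sub>m id_pmap \<in> carrier PO_plus"
      by (simp add: map_comp_assoc ba)
    then show False using PO_plus_disjoint_varpi_PO_plus[OF id_plus] by simp
  qed
  have total: "dom \<gamma> = N2" if "\<gamma> \<in> carrier PO_inf" "\<delta> \<circ>\<^sub>m \<gamma> = id_pmap" for \<gamma> \<delta>
  proof
    show "dom \<gamma> \<subseteq> N2" using PO_inf_range(1)[OF that(1)] by blast
    show "N2 \<subseteq> dom \<gamma>"
    proof
      fix x assume "x \<in> N2"
      then have "(\<delta> \<circ>\<^sub>m \<gamma>) x = Some x" using that(2) by (simp add: id_pmap_apply)
      then show "x \<in> dom \<gamma>" by (auto simp: map_comp_Some_iff)
    qed
  qed
  show ?thesis
  proof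
    fix z
    show "\<alpha> z = id_pmap z"
    proof (cases "z \<in> N2")
      case True
      then have "(\<beta> \<circ>\<^sub>m \<alpha>) z = Some z" using ba by (simp add: id_pmap_apply)
      then obtain w where w: "\<alpha> z = Some w" "\<beta> w = Some z" by (auto simp: map_comp_Some_iff)
      have "z \<le> w" using PO_plus_total_inflationary[OF a total[OF inf ba] w(1)] .
      moreover have "w \<le> z" using PO_plus_total_inflationary[OF b_plus total[OF b ab] w(2)] .
      ultimately show ?thesis using w True by (simp add: id_pmap_apply)
    next
      case False
      then show ?thesis using PO_inf_range(1)[OF inf, of z] by (cases "\<alpha> z") (auto simp: id_pmap_apply)
    qed
  qed
qed

lemma Units_PO_inf: "Units PO_inf = {id_pmap, varpi}"
proof
  show "{id_pmap, varpi} \<subseteq> Units PO_inf"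
    using id_pmap_closed varpi_closed varpi_varpi PO_inf_id_left[OF id_pmap_closed]
    by (auto simp: Units_def PO_inf_mult PO_inf_one)
  show "Units PO_inf \<subseteq> {id_pmap, varpi}"
  proof
    fix \<alpha> assume "\<alpha> \<in> Units PO_inf"
    then obtain \<beta> where a: "\<alpha> \<in> carrier PO_inf" and b: "\<beta> \<in> carrier PO_inf"
      and ba: "\<beta> \<circ>\<^sub>m \<alpha> = id_pmap" and ab: "\<alpha> \<circ>\<^sub>m \<beta> = id_pmap"
      by (auto simp: Units_def PO_inf_mult PO_inf_one)
    show "\<alpha> \<in> {id_pmap, varpi}"
    proof (cases "\<alpha> \<in> carrier PO_plus")
      case True
      then show ?thesis using PO_plus_unit b ba ab by blast
    next
      case False
      then have plus: "varpi \<circ>\<^sub>m \<alpha> \<in> carrier PO_plus" using PO_plus_or_varpi_PO_plus[OF a] by simp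
      have "(\<beta> \<circ>\<^sub>m varpi) \<circ>\<^sub>m (varpi \<circ>\<^sub>m \<alpha>) = \<beta> \<circ>\<^sub>m ((varpi \<circ>\<^sub>m varpi) \<circ>\<^sub>m \<alpha>)"
        by (simp add: map_comp_assoc)
      then have left: "(\<beta> \<circ>\<^sub>m varpi) \<circ>\<^sub>m (varpi \<circ>\<^sub>m \<alpha>) = id_pmap"
        by (simp add: varpi_varpi PO_inf_id_right[OF a] ba)
      have "(varpi \<circ>\<^sub>m \<alpha>) \<circ>\<^sub>m (\<beta> \<circ>\<^sub>m varpi) = varpi \<circ>\<^sub>m ((\<alpha> \<circ>\<^sub>m \<beta>) \<circ>\<^sub>m varpi)"
        by (simp add: map_comp_assoc)
      then have right: "(varpi \<circ>\<^sub>m \<alpha>) \<circ>\<^sub>m (\<beta> \<circ>\<^sub>m varpi) = id_pmap"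
        by (simp add: ab PO_inf_id_right[OF varpi_closed] varpi_varpi)
      have "varpi \<circ>\<^sub>m \<alpha> = id_pmap"
        using PO_plus_unit[OF plus PO_inf_comp_closed[OF varpi_closed b] left right] .
      then have "\<alpha> = varpi \<circ>\<^sub>m id_pmap" using varpi_involution[OF a] by simp
      then show ?thesis by (simp add: PO_inf_id_left[OF varpi_closed])
    qed
  qed
qed

lemma varpi_neq_id: "varpi \<noteq> id_pmap"
proof
  assume "varpi = id_pmap"
  then have "varpi (1, 2) = id_pmap (1, 2)" by simp
  then show False by (simp add: varpi_apply id_pmap_apply N2_iff)
qed

section \<open>The decomposition\<close>

lemma iso_semidirect_PO_inf:
  "(\<lambda>(s, t). s \<otimes>\<^bsub>PO_inf\<^esub> t) \<in> iso (semidirect PO_plus (units_of PO_inf) Q_act) PO_inf"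
proof (rule isoI)
  let ?G = "semidirect PO_plus (units_of PO_inf) Q_act"
  let ?F = "\<lambda>(s, t). s \<otimes>\<^bsub>PO_inf\<^esub> t"
  have carrier: "carrier ?G = carrier PO_plus \<times> {id_pmap, varpi}"
    by (simp add: semidirect_def units_of_carrier Units_PO_inf)
  have mult: "(s, t) \<otimes>\<^bsub>?G\<^esub> (s', t') = (Q_act t s' \<circ>\<^sub>m s, t' \<circ>\<^sub>m t)" for s t s' t'
    by (simp add: semidirect_def units_of_mult PO_plus_def PO_inf_mult)
  have sub: "s \<in> carrier PO_inf" if "s \<in> carrier PO_plus" for s
    using that by (simp add: PO_plus_iff)
  have Q_id: "Q_act id_pmap s = s" for s by (simp add: Q_act_def)
  have Q_varpi: "Q_act varpi s = varpi \<circ>\<^sub>m (s \<circ>\<^sub>m varpi)" for s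
    by (simp add: Q_act_def varpi_neq_id PO_inf_mult)
  have F: "?F (s, t) = t \<circ>\<^sub>m s" for s t by (simp add: PO_inf_mult)
  \<comment> \<open>The action is conjugation by an involution, so it records how a unit is moved past an element.\<close>
  have twist: "t \<circ>\<^sub>m Q_act t s = s \<circ>\<^sub>m t"
    if "s \<in> carrier PO_plus" "t \<in> {id_pmap, varpi}" for s t
    using that sub[OF that(1)]
    by (auto simp: Q_id Q_varpi PO_inf_id_left PO_inf_id_right PO_inf_comp_closed varpi_closed
        varpi_involution)
  show "?F \<in> hom ?G PO_inf"
  proof (rule homI)
    fix x assume "x \<in> carrier ?G"
    then show "?F x \<in> carrier PO_inf"
      using sub PO_inf_comp_closed id_pmap_closed varpi_closed by (auto simp: carrier PO_inf_mult)
  next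
    fix x y assume xy: "x \<in> carrier ?G" "y \<in> carrier ?G"
    obtain s t s' t' where st: "x = (s, t)" "y = (s', t')" by fastforce
    have "?F (x \<otimes>\<^bsub>?G\<^esub> y) = t' \<circ>\<^sub>m ((t \<circ>\<^sub>m Q_act t s') \<circ>\<^sub>m s)"
      by (simp only: st mult F map_comp_assoc)
    also have "\<dots> = t' \<circ>\<^sub>m ((s' \<circ>\<^sub>m t) \<circ>\<^sub>m s)"
      using twist[of s' t] xy st by (simp add: carrier)
    also have "\<dots> = ?F x \<otimes>\<^bsub>PO_inf\<^esub> ?F y" by (simp add: st PO_inf_mult map_comp_assoc)
    finally show "?F (x \<otimes>\<^bsub>?G\<^esub> y) = ?F x \<otimes>\<^bsub>PO_inf\<^esub> ?F y" .
  qed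
  show "bij_betw ?F (carrier ?G) (carrier PO_inf)"
  proof (rule bij_betw_imageI)
    show "inj_on ?F (carrier ?G)"
    proof (rule inj_onI, clarify)
      fix s t s' t'
      assume st: "(s, t) \<in> carrier ?G" "(s', t') \<in> carrier ?G"
        and "s \<otimes>\<^bsub>PO_inf\<^esub> t = s' \<otimes>\<^bsub>PO_inf\<^esub> t'"
      then have eq: "t \<circ>\<^sub>m s = t' \<circ>\<^sub>m s'" by (simp add: PO_inf_mult)
      have s: "s \<in> carrier PO_plus" "s' \<in> carrier PO_plus" using st by (auto simp: carrier)
      then consider "t = id_pmap" "t' = id_pmap" | "t = varpi" "t' = varpi"
        | "t = id_pmap" "t' = varpi" | "t = varpi" "t' = id_pmap"
        using st by (auto simp: carrier)
      then show "s = s' \<and> t = t'"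
      proof cases
        case 1
        then show ?thesis using eq s sub PO_inf_id_right by metis
      next
        case 2
        then show ?thesis using eq s sub varpi_involution by metis
      next
        case 3
        then show ?thesis using eq s sub PO_inf_id_right PO_plus_disjoint_varpi_PO_plus by metis
      next
        case 4
        then show ?thesis using eq s sub PO_inf_id_right PO_plus_disjoint_varpi_PO_plus by metis
      qed
    qed
    show "?F ` carrier ?G = carrier PO_inf"
    proof
      show "?F ` carrier ?G \<subseteq> carrier PO_inf"
        using sub PO_inf_comp_closed id_pmap_closed varpi_closed by (auto simp: carrier PO_inf_mult)
      show "carrier PO_inf \<subseteq> ?F ` carrier ?G"
      proof
        fix \<alpha> assume a: "\<alpha> \<in> carrier PO_inf"
        from PO_plus_or_varpi_PO_plus[OF a] show "\<alpha> \<in> ?F ` carrier ?G"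
        proof
          assume "\<alpha> \<in> carrier PO_plus"
          then show ?thesis
            by (intro image_eqI[of _ _ "(\<alpha>, id_pmap)"]) (simp_all add: carrier F PO_inf_id_right[OF a] PO_inf_mult)
        next
          assume "varpi \<circ>\<^sub>m \<alpha> \<in> carrier PO_plus"
          then show ?thesis
            by (intro image_eqI[of _ _ "(varpi \<circ>\<^sub>m \<alpha>, varpi)"])
              (simp_all add: carrier varpi_involution[OF a] PO_inf_mult)
        qed
      qed
    qed
  qed
qed

text \<open>
  Closure of the domain under multiplication is all that inverting an isomorphism takes, so this
  applies to semigroups and not only to groups.
\<close>

lemma iso_inv_into:
  fixes G (structure)
  assumes h: "h \<in> iso G H"
    and closed: "\<And>x y. x \<in> carrier G \<Longrightarrow> y \<in> carrier G \<Longrightarrow> x \<otimes> y \<in> carrier G"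
  shows "inv_into (carrier G) h \<in> iso H G"
proof (rule isoI)
  have hom: "h \<in> hom G H" and bij: "bij_betw h (carrier G) (carrier H)"
    using h by (simp_all add: iso_def)
  show bij': "bij_betw (inv_into (carrier G) h) (carrier H) (carrier G)"
    using bij by (rule bij_betw_inv_into)
  show "inv_into (carrier G) h \<in> hom H G"
  proof (rule homI)
    show into: "inv_into (carrier G) h x \<in> carrier G" if "x \<in> carrier H" for x
      using bij' that by (rule bij_betwE[THEN bspec])
    fix x y assume "x \<in> carrier H" "y \<in> carrier H"
    then show "inv_into (carrier G) h (x \<otimes>\<^bsub>H\<^esub> y) = inv_into (carrier G) h x \<otimes> inv_into (carrier G) h y"
      using into closed hom bij
      by (intro inv_into_f_eq) (simp_all add: bij_betw_def hom_mult f_inv_into_f)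
  qed
qed

lemma semidirect_PO_plus_closed:
  assumes "x \<in> carrier (semidirect PO_plus (units_of PO_inf) Q_act)"
    and "y \<in> carrier (semidirect PO_plus (units_of PO_inf) Q_act)"
  shows "x \<otimes>\<^bsub>semidirect PO_plus (units_of PO_inf) Q_act\<^esub> y
    \<in> carrier (semidirect PO_plus (units_of PO_inf) Q_act)"
proof -
  obtain s t s' t' where st: "x = (s, t)" "y = (s', t')" by fastforce
  have s: "s \<in> carrier PO_plus" "s' \<in> carrier PO_plus"
    and t: "t \<in> Units PO_inf" "t' \<in> Units PO_inf"
    using assms by (auto simp: st semidirect_def units_of_carrier)
  have "Q_act t s' \<in> carrier PO_plus"
    using t(1) s(2) PO_plus_conj_varpi[OF s(2)] varpi_neq_id
    by (auto simp: Units_PO_inf Q_act_def PO_inf_mult)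
  then have "Q_act t s' \<circ>\<^sub>m s \<in> carrier PO_plus" using PO_plus_mult_closed[OF s(1)] by simp
  moreover have "t \<otimes>\<^bsub>PO_inf\<^esub> t' \<in> Units PO_inf"
    using monoid.Units_m_closed[OF monoid_PO_inf t] .
  ultimately show ?thesis
    by (simp add: st semidirect_def units_of_carrier units_of_mult PO_plus_def PO_inf_mult)
qed

theorem theorem12: "PO_inf \<cong> semidirect PO_plus (units_of PO_inf) Q_act"
  using iso_inv_into[OF iso_semidirect_PO_inf semidirect_PO_plus_closed] by (auto simp: is_iso_def)

end
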